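(* (i) For every $n\geq 4$, $\chi'^t_d(W_n)=n-1$, where $W_n$ is the wheel of order $n$. (ii) For every $n\geq 2$, $\chi'^t_d(F_n)=2n$, where $F_n$ is the friendship graph with $2n+1$ vertices and $3n$ edges.
   Context: Graphs are simple. Two edges are adjacent if they are distinct and share an endpoint. A total dominator edge coloring (TDE-coloring) of a graph $G$ is a proper edge coloring of $G$ in which each edge of $G$ is adjacent to every edge of some color class (a color class is the set of all edges assigned a given used color). The total dominator edge chromatic number $\chi'^t_d(G)$ is the minimum number of color classes in a TDE-coloring of $G$. The wheel $W_n$ of order $n$ is the graph on $n$ vertices that is the join of $K_1$ with the cycle $C_{n-1}$. The friendship graph $F_n$ is the join of $K_1$ with $nK_2$ (the disjoint union of $n$ copies of $K_2$). *)

theory Defs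
  imports Main
begin

section \<open>Finite simple graphs\<close>

record 'v graph =
  verts :: "'v set"
  edges :: "'v set set"

definition simple_graph :: "'v graph \<Rightarrow> bool" where
  "simple_graph G \<longleftrightarrow> finite (verts G) \<and> (\<forall>e\<in>edges G. e \<subseteq> verts G \<and> card e = 2)"

definition complete_graph :: "nat \<Rightarrow> nat graph" where
  "complete_graph n = \<lparr>verts = {..<n}, edges = {{i, j} | i j. i < n \<and> j < n \<and> i \<noteq> j}\<rparr>"

text \<open>Only meaningful for \<open>n \<ge> 3\<close>: for \<open>n = 1\<close> a degenerate singleton edge would appear.\<close>

definition cycle_graph :: "nat \<Rightarrow> nat graph" where
  "cycle_graph n = \<lparr>verts = {..<n}, edges = {{i, Suc i mod n} | i. i < n}\<rparr>"

definition graph_join :: "'v graph \<Rightarrow> 'w graph \<Rightarrow> ('v + 'w) graph" where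
  "graph_join G H = \<lparr>
     verts = verts G <+> verts H,
     edges = (\<lambda>e. Inl ` e) ` edges G \<union> (\<lambda>e. Inr ` e) ` edges H
             \<union> {{Inl u, Inr v} | u v. u \<in> verts G \<and> v \<in> verts H}\<rparr>"

text \<open>The disjoint union \<open>n G\<close>; the copies are told apart by the first component.\<close>

definition graph_copies :: "nat \<Rightarrow> 'v graph \<Rightarrow> (nat \<times> 'v) graph" where
  "graph_copies n G = \<lparr>
     verts = {..<n} \<times> verts G,
     edges = {Pair k ` e | k e. k < n \<and> e \<in> edges G}\<rparr>"

text \<open>The index is the order of the wheel, so the rim is a cycle on \<open>n - 1\<close> vertices.\<close>

definition wheel_graph :: "nat \<Rightarrow> (nat + nat) graph" where
  "wheel_graph n = graph_join (complete_graph 1) (cycle_graph (n - 1))"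

definition friendship_graph :: "nat \<Rightarrow> (nat + nat \<times> nat) graph" where
  "friendship_graph n = graph_join (complete_graph 1) (graph_copies n (complete_graph 2))"

section \<open>Total dominator edge colorings\<close>

definition adjacent_edges :: "'v set \<Rightarrow> 'v set \<Rightarrow> bool" where
  "adjacent_edges e f \<longleftrightarrow> e \<noteq> f \<and> e \<inter> f \<noteq> {}"

text \<open>Values of a coloring outside the edge set are irrelevant; the used colors are
  \<open>c ` edges G\<close>.\<close>

definition color_class :: "'v graph \<Rightarrow> ('v set \<Rightarrow> nat) \<Rightarrow> nat \<Rightarrow> 'v set set" where
  "color_class G c k = {e \<in> edges G. c e = k}"

definition color_classes :: "'v graph \<Rightarrow> ('v set \<Rightarrow> nat) \<Rightarrow> 'v set set set" where
  "color_classes G c = color_class G c ` c ` edges G"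

definition proper_edge_coloring :: "'v graph \<Rightarrow> ('v set \<Rightarrow> nat) \<Rightarrow> bool" where
  "proper_edge_coloring G c \<longleftrightarrow>
     (\<forall>e\<in>edges G. \<forall>f\<in>edges G. adjacent_edges e f \<longrightarrow> c e \<noteq> c f)"

definition tde_coloring :: "'v graph \<Rightarrow> ('v set \<Rightarrow> nat) \<Rightarrow> bool" where
  "tde_coloring G c \<longleftrightarrow> proper_edge_coloring G c \<and>
     (\<forall>e\<in>edges G. \<exists>C\<in>color_classes G c. \<forall>f\<in>C. adjacent_edges e f)"

text \<open>On \<open>nat\<close>, \<open>Inf\<close> is the minimum of a nonempty set and \<open>Inf {} = 0\<close>.  A finite graph with at
  least one edge has no TDE-coloring with \<open>0\<close> classes, so a positive value is always attained.\<close>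

definition tde_chromatic_number :: "'v graph \<Rightarrow> nat" where
  "tde_chromatic_number G = Inf {card (color_classes G c) | c. tde_coloring G c}"

section \<open>The wheels and friendship graphs are simple, with the expected numbers of vertices and edges\<close>

lemma simple_graph_complete_graph: "simple_graph (complete_graph n)"
  by (auto simp: simple_graph_def complete_graph_def)

lemma simple_graph_cycle_graph:
  assumes "n \<ge> 3"
  shows "simple_graph (cycle_graph n)"
proof -
  have "i \<noteq> Suc i mod n" if "i < n" for i
    using assms that by (cases "Suc i = n") auto
  then show ?thesis
    using assms by (auto simp: simple_graph_def cycle_graph_def)
qed

lemma simple_graph_graph_copies:
  assumes "simple_graph G"
  shows "simple_graph (graph_copies n G)"
proof -
  have "card (Pair k ` e) = card e" for k :: nat and e :: "'a set"
    by (rule card_image) (auto simp: inj_on_def)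
  with assms show ?thesis
    by (fastforce simp: simple_graph_def graph_copies_def)
qed

lemma simple_graph_graph_join:
  assumes "simple_graph G" "simple_graph H"
  shows "simple_graph (graph_join G H)"
  using assms
  by (auto simp: simple_graph_def graph_join_def card_image)

lemma simple_graph_wheel_graph: "n \<ge> 4 \<Longrightarrow> simple_graph (wheel_graph n)"
  unfolding wheel_graph_def
  by (intro simple_graph_graph_join simple_graph_complete_graph simple_graph_cycle_graph) simp

lemma simple_graph_friendship_graph: "simple_graph (friendship_graph n)"
  unfolding friendship_graph_def
  by (intro simple_graph_graph_join simple_graph_complete_graph simple_graph_graph_copies)

lemma card_verts_wheel_graph: "n \<ge> 1 \<Longrightarrow> card (verts (wheel_graph n)) = n"
  by (simp add: wheel_graph_def graph_join_def complete_graph_def cycle_graph_def card_Plus)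

lemma card_verts_friendship_graph: "card (verts (friendship_graph n)) = 2 * n + 1"
  by (simp add: friendship_graph_def graph_join_def graph_copies_def complete_graph_def card_Plus)

lemma card_edges_friendship_graph: "card (edges (friendship_graph n)) = 3 * n"
proof -
  define A :: "(nat + nat \<times> nat) set set"
    where "A = (\<lambda>k. {Inr (k, 0), Inr (k, 1)}) ` {..<n}"
  define B :: "(nat + nat \<times> nat) set set"
    where "B = (\<lambda>v. {Inl 0, Inr v}) ` ({..<n} \<times> {..<2})"
  have K2: "edges (complete_graph 2) = {{0, 1}}"
    by (auto simp: complete_graph_def less_2_cases_iff doubleton_eq_iff)
  have E: "edges (friendship_graph n) = A \<union> B"
  proof -
    have "edges (graph_copies n (complete_graph 2)) = (\<lambda>k. {(k, 0), (k, 1)}) ` {..<n}"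
      by (auto simp: graph_copies_def K2)
    moreover have "verts (graph_copies n (complete_graph 2)) = {..<n} \<times> {..<2}"
      by (simp add: graph_copies_def complete_graph_def)
    ultimately show ?thesis
      unfolding friendship_graph_def graph_join_def A_def B_def
      by (auto simp: complete_graph_def image_image)
  qed
  have "card A = n"
    unfolding A_def by (subst card_image) (auto simp: inj_on_def doubleton_eq_iff)
  moreover have "card B = 2 * n"
    unfolding B_def by (subst card_image) (auto simp: inj_on_def doubleton_eq_iff)
  moreover have "A \<inter> B = {}" "finite A" "finite B"
    by (auto simp: A_def B_def)
  ultimately show ?thesis
    by (simp add: E card_Un_disjoint)
qed

end

theory Submission imports Defs begin

text \<open>
  Both graphs are cones: one apex joined to every vertex of a base graph \<open>H\<close>, a cycle or a disjoint
  union of copies of \<open>K\<^sub>2\<close>.  The spokes all meet in the apex, so a proper coloring needs a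
  separate color for each vertex of \<open>H\<close>; this is the lower bound in both cases.

  For the upper bound no further color may be spent, so each edge \<open>e\<close> of \<open>H\<close> has to share its
  color with the spoke at some vertex \<open>g e\<close>.  The color classes are then the spokes at the vertices
  \<open>v\<close>, each together with the edges \<open>e\<close> such that \<open>g e = v\<close>, and it only remains to say which \<open>g\<close>
  make this a TDE-coloring (\<open>tde_chromatic_number_cone\<close>).

  On the cycle, the edge from \<open>i\<close> to \<open>i + 1\<close> is matched with the vertex \<open>i + 2\<close>.  The class of the
  spoke at \<open>i + 1\<close> is then completed by the edge from \<open>i - 1\<close> to \<open>i\<close>, and both of its members are
  adjacent to the rim edge from \<open>i\<close> to \<open>i + 1\<close> and to the spoke at \<open>i\<close>.  On \<open>n K\<^sub>2\<close>, the edge of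
  each copy is matched with the first vertex of the next copy, which leaves the spokes at all second
  vertices as singleton classes; the edge of a copy meets the one in its own copy, and a spoke meets
  the one in any other copy.
\<close>

section \<open>Counting color classes\<close>

lemma card_color_classes: "card (color_classes G c) = card (c ` edges G)"
  unfolding color_classes_def
  by (rule card_image) (auto simp: inj_on_def color_class_def)

lemma card_pairwise_adjacent_le_color_classes:
  assumes "proper_edge_coloring G c" and "finite (edges G)" and "S \<subseteq> edges G"
    and "\<And>e f. e \<in> S \<Longrightarrow> f \<in> S \<Longrightarrow> e \<noteq> f \<Longrightarrow> adjacent_edges e f"
  shows "card S \<le> card (color_classes G c)"
proof -
  have "inj_on c S"
    using assms(1,3,4) by (fastforce simp: inj_on_def proper_edge_coloring_def)
  then have "card S = card (c ` S)"
    by (simp add: card_image)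
  also have "\<dots> \<le> card (c ` edges G)"
    using assms(2,3) by (intro card_mono image_mono finite_imageI)
  finally show ?thesis
    by (simp add: card_color_classes)
qed

lemma finite_edges_simple_graph: "simple_graph G \<Longrightarrow> finite (edges G)"
  by (rule finite_subset[of _ "Pow (verts G)"]) (auto simp: simple_graph_def)

section \<open>Cones\<close>

definition cone :: "'v graph \<Rightarrow> (nat + 'v) graph" where
  "cone H = graph_join (complete_graph 1) H"

abbreviation spoke :: "'v \<Rightarrow> (nat + 'v) set" where
  "spoke v \<equiv> {Inl 0, Inr v}"

lemma edges_cone: "edges (cone H) = image Inr ` edges H \<union> spoke ` verts H"
  by (auto simp: cone_def graph_join_def complete_graph_def)

lemma simple_graph_cone: "simple_graph H \<Longrightarrow> simple_graph (cone H)"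
  unfolding cone_def by (intro simple_graph_graph_join simple_graph_complete_graph)

lemma adjacent_edges_Inr [simp]:
  "adjacent_edges (Inr ` e) (Inr ` f) \<longleftrightarrow> adjacent_edges e f"
  by (auto simp: adjacent_edges_def inj_image_eq_iff)

lemma adjacent_edges_spoke_spoke [simp]: "adjacent_edges (spoke u) (spoke v) \<longleftrightarrow> u \<noteq> v"
  by (auto simp: adjacent_edges_def doubleton_eq_iff)

lemma adjacent_edges_spoke_Inr [simp]:
  "adjacent_edges (spoke v) (Inr ` e) \<longleftrightarrow> v \<in> e"
  "adjacent_edges (Inr ` e) (spoke v) \<longleftrightarrow> v \<in> e"
  by (auto simp: adjacent_edges_def)

text \<open>The spokes are pairwise adjacent, since all of them contain the apex.\<close>

lemma card_verts_le_color_classes_cone: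
  assumes "simple_graph H" and "proper_edge_coloring (cone H) c"
  shows "card (verts H) \<le> card (color_classes (cone H) c)"
proof -
  have "card (verts H) = card (spoke ` verts H)"
    by (rule card_image[symmetric]) (auto simp: inj_on_def doubleton_eq_iff)
  also have "\<dots> \<le> card (color_classes (cone H) c)"
    using assms
    by (intro card_pairwise_adjacent_le_color_classes finite_edges_simple_graph
          simple_graph_cone) (auto simp: edges_cone)
  finally show ?thesis .
qed

text \<open>The color of an edge \<open>e\<close> of \<open>H\<close> is that of the spoke at \<open>g e\<close>.  The conditions \<open>off\<close> and \<open>proper\<close>
  say that the resulting coloring is proper; \<open>rim\<close> and \<open>spokes\<close> provide, for an edge of \<open>H\<close> and for
  a spoke respectively, a vertex \<open>v\<close> such that it is adjacent to the whole class of the spoke at \<open>v\<close>.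
  For an edge \<open>e\<close> of \<open>H\<close> this forces \<open>v \<in> e\<close>, because every class contains a spoke.\<close>

lemma tde_chromatic_number_cone:
  assumes simple: "simple_graph H"
    and into: "\<And>e. e \<in> edges H \<Longrightarrow> g e \<in> verts H"
    and off: "\<And>e. e \<in> edges H \<Longrightarrow> g e \<notin> e"
    and proper: "\<And>e f. e \<in> edges H \<Longrightarrow> f \<in> edges H \<Longrightarrow> adjacent_edges e f \<Longrightarrow> g e \<noteq> g f"
    and rim: "\<And>e. e \<in> edges H \<Longrightarrow> \<exists>v\<in>e. \<forall>f\<in>edges H. g f = v \<longrightarrow> adjacent_edges e f"
    and spokes: "\<And>u. u \<in> verts H \<Longrightarrow> \<exists>v\<in>verts H. v \<noteq> u \<and> (\<forall>f\<in>edges H. g f = v \<longrightarrow> u \<in> f)"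
  shows "tde_chromatic_number (cone H) = card (verts H)"
proof -
  have sub: "v \<in> verts H" if "e \<in> edges H" "v \<in> e" for e v
    using simple that by (auto simp: simple_graph_def)
  obtain h :: "'a \<Rightarrow> nat" where inj: "inj_on h (verts H)"
    using simple finite_imp_inj_to_nat_seg[of "verts H"] by (auto simp: simple_graph_def)
  have h_eq: "h u = h v \<longleftrightarrow> u = v" if "u \<in> verts H" "v \<in> verts H" for u v
    using inj that by (auto simp: inj_on_def)
  define c where "c e = h (if Inl 0 \<in> e then THE v. Inr v \<in> e else g (Inr -` e))"
    for e :: "(nat + 'a) set"
  have c_spoke [simp]: "c (spoke v) = h v" for v
    by (simp add: c_def)
  have c_Inr [simp]: "c (Inr ` e) = h (g e)" for e
    by (auto simp: c_def inj_vimage_image_eq)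

  have "proper_edge_coloring (cone H) c"
    unfolding proper_edge_coloring_def edges_cone
    using proper off by (auto simp: h_eq into)

  moreover have class_of: "color_class (cone H) c (h v) \<in> color_classes (cone H) c"
    if "v \<in> verts H" for v
  proof -
    have "spoke v \<in> edges (cone H)"
      using that by (simp add: edges_cone)
    then show ?thesis
      unfolding color_classes_def using c_spoke[of v] by (metis image_eqI)
  qed
  have members: "F \<in> color_class (cone H) c (h v) \<longleftrightarrow>
      F = spoke v \<or> (\<exists>f\<in>edges H. g f = v \<and> F = Inr ` f)" if "v \<in> verts H" for F v
    using that by (auto simp: color_class_def edges_cone h_eq into)
  have "\<exists>C\<in>color_classes (cone H) c. \<forall>F\<in>C. adjacent_edges E F" if "E \<in> edges (cone H)" for E
  proof -
    from that consider (base) e where "e \<in> edges H" "E = Inr ` e"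
      | (apex) u where "u \<in> verts H" "E = spoke u"
      by (auto simp: edges_cone)
    then show ?thesis
    proof cases
      case base
      with rim obtain v where v: "v \<in> e" "\<forall>f\<in>edges H. g f = v \<longrightarrow> adjacent_edges e f"
        by blast
      then have "v \<in> verts H"
        using base sub by blast
      with v base show ?thesis
        by (intro bexI[OF _ class_of[of v]]) (auto simp: members)
    next
      case apex
      with spokes obtain v where "v \<in> verts H" "v \<noteq> u" "\<forall>f\<in>edges H. g f = v \<longrightarrow> u \<in> f"
        by blast
      with apex show ?thesis
        by (intro bexI[OF _ class_of[of v]]) (auto simp: members)
    qed
  qed
  ultimately have tde: "tde_coloring (cone H) c"
    by (simp add: tde_coloring_def)

  have "c ` edges (cone H) = h ` verts H"
    by (auto simp: edges_cone image_Un image_image into)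
  then have "card (color_classes (cone H) c) = card (verts H)"
    by (simp add: card_color_classes card_image inj)
  with tde show ?thesis
    unfolding tde_chromatic_number_def
    using card_verts_le_color_classes_cone[OF simple]
    by (intro cInf_eq_minimum) (auto simp: tde_coloring_def intro!: exI[of _ c])
qed

section \<open>Wheels\<close>

text \<open>Writing \<open>s\<close> for the successor on the cycle, all that matters is that \<open>s\<close> is injective and that
  \<open>i\<close>, \<open>s i\<close> and \<open>s (s i)\<close> are distinct.\<close>

lemma tde_chromatic_number_cone_cycle:
  assumes m: "m \<ge> 3"
  shows "tde_chromatic_number (cone (cycle_graph m)) = m"
proof -
  define s where "s i = Suc i mod m" for i
  define r where "r i = {i, s i}" for i
  have s_less: "s i < m" for i
    using m by (simp add: s_def)
  have s_neq: "s i \<noteq> i" "s (s i) \<noteq> i" if "i < m" for i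
    using that m by (auto simp: s_def mod_Suc)
  have s_inj: "s i = s j \<longleftrightarrow> i = j" if "i < m" "j < m" for i j
    using that by (auto simp: s_def mod_Suc split: if_splits)
  have r_inj: "r i = r j \<longleftrightarrow> i = j" if "i < m" "j < m" for i j
    using that s_neq by (auto simp: r_def doubleton_eq_iff)
  then have "inj_on r {..<m}"
    by (auto simp: inj_on_def)
  then have inv: "the_inv_into {..<m} r (r i) = i" if "i < m" for i
    using that by (simp add: the_inv_into_f_f)
  have E: "edges (cycle_graph m) = r ` {..<m}" and V: "verts (cycle_graph m) = {..<m}"
    by (auto simp: cycle_graph_def r_def s_def)
  define g where "g e = s (s (the_inv_into {..<m} r e))" for e
  have g: "g (r i) = s (s i)" if "i < m" for i
    using that by (simp add: g_def inv)
  have "tde_chromatic_number (cone (cycle_graph m)) = card (verts (cycle_graph m))"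
  proof (rule tde_chromatic_number_cone[where g = g])
    show "simple_graph (cycle_graph m)"
      using m by (rule simple_graph_cycle_graph)
    show "g e \<in> verts (cycle_graph m)" for e
      by (simp add: V g_def s_less)
    show "g e \<notin> e" if "e \<in> edges (cycle_graph m)" for e
      using that s_neq s_less by (auto simp: E g) (auto simp: r_def)
    show "g e \<noteq> g f" if "e \<in> edges (cycle_graph m)" "f \<in> edges (cycle_graph m)"
      "adjacent_edges e f" for e f
      using that by (auto simp: E g s_inj s_less adjacent_edges_def)
    show "\<exists>v\<in>e. \<forall>f\<in>edges (cycle_graph m). g f = v \<longrightarrow> adjacent_edges e f"
      if e: "e \<in> edges (cycle_graph m)" for e
    proof -
      obtain i where i: "i < m" "e = r i"
        using e by (auto simp: E)
      have "adjacent_edges e (r j)" if "j < m" "g (r j) = s i" for j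
      proof -
        have "s j = i"
          using that i by (simp add: g s_inj s_less)
        then show ?thesis
          using that i s_neq[of j] by (auto simp: adjacent_edges_def r_inj) (auto simp: r_def)
      qed
      moreover have "s i \<in> e"
        by (simp add: i r_def)
      ultimately show ?thesis
        by (auto simp: E)
    qed
    show "\<exists>v\<in>verts (cycle_graph m). v \<noteq> u \<and> (\<forall>f\<in>edges (cycle_graph m). g f = v \<longrightarrow> u \<in> f)"
      if "u \<in> verts (cycle_graph m)" for u
      using that s_neq[of u]
      by (intro bexI[of _ "s u"]) (auto simp: V E g s_inj s_less, auto simp: r_def)
  qed
  then show ?thesis
    by (simp add: V)
qed

section \<open>Friendship graphs\<close>

lemma tde_chromatic_number_friendship_graph:
  assumes n: "n \<ge> 2"
  shows "tde_chromatic_number (friendship_graph n) = 2 * n"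
proof -
  define H where "H = graph_copies n (complete_graph 2)"
  define t :: "nat \<Rightarrow> (nat \<times> nat) set" where "t k = {(k, 0), (k, 1)}" for k
  have "edges (complete_graph 2) = {{0, 1}}"
    by (auto simp: complete_graph_def less_2_cases_iff doubleton_eq_iff)
  then have E: "edges H = t ` {..<n}"
    by (auto simp: H_def graph_copies_def t_def)
  have V: "verts H = {..<n} \<times> {..<2}"
    by (simp add: H_def graph_copies_def complete_graph_def)
  define s where "s k = Suc k mod n" for k
  have s_less: "s k < n" for k
    using n by (simp add: s_def)
  have s_neq: "s k \<noteq> k" if "k < n" for k
    using that n by (auto simp: s_def mod_Suc)
  \<comment> \<open>On the edge \<open>t k\<close> the minimum picks out the index \<open>k\<close> of the copy.\<close>
  define g :: "(nat \<times> nat) set \<Rightarrow> nat \<times> nat" where "g e = (s (Min (fst ` e)), 0)" for e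
  have g: "g (t k) = (s k, 0)" for k
    by (simp add: g_def t_def)
  have "tde_chromatic_number (cone H) = card (verts H)"
  proof (rule tde_chromatic_number_cone[where g = g])
    show "simple_graph H"
      unfolding H_def by (intro simple_graph_graph_copies simple_graph_complete_graph)
    show "g e \<in> verts H" for e
      by (simp add: V g_def s_less)
    show "g e \<notin> e" if "e \<in> edges H" for e
      using that s_neq by (auto simp: E g) (auto simp: t_def)
    show "g e \<noteq> g f" if "e \<in> edges H" "f \<in> edges H" "adjacent_edges e f" for e f
      using that by (auto simp: E adjacent_edges_def t_def)
    show "\<exists>v\<in>e. \<forall>f\<in>edges H. g f = v \<longrightarrow> adjacent_edges e f" if e: "e \<in> edges H" for e
    proof -
      obtain k where "e = t k"
        using e by (auto simp: E)
      then show ?thesis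
        by (intro bexI[of _ "(k, 1)"]) (auto simp: E g, auto simp: t_def)
    qed
    show "\<exists>v\<in>verts H. v \<noteq> u \<and> (\<forall>f\<in>edges H. g f = v \<longrightarrow> u \<in> f)" if "u \<in> verts H" for u
      using that s_neq s_less
      by (intro bexI[of _ "(s (fst u), 1)"]) (auto simp: V E g)
  qed
  then show ?thesis
    unfolding friendship_graph_def H_def[symmetric] cone_def[symmetric] by (simp add: V)
qed

theorem theorem2p11:
  "(\<forall>n\<ge>4. tde_chromatic_number (wheel_graph n) = n - 1) \<and>
   (\<forall>n\<ge>2. tde_chromatic_number (friendship_graph n) = 2 * n)"
  using tde_chromatic_number_cone_cycle
  by (simp add: wheel_graph_def cone_def tde_chromatic_number_friendship_graph)

end
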